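(* Let $1<p<\infty$, let $\sigma_1 \ge \sigma_2 \ge \dots \ge \sigma_k \ge \dots \ge 0$ be real numbers, and let $D : \ell_p \to \ell_p$ be the operator defined by $$D((\zeta_1,\zeta_2,\dots,\zeta_k,\dots)) = (\sigma_1\zeta_1,\sigma_2\zeta_2,\dots,\sigma_k\zeta_k,\dots), \qquad (\zeta_k) \in \ell_p.$$ Then for each $n \in \mathbb{N}$: if $\ell_p$ is the real $\ell_p$ space, $$\sup_{1\le k<\infty} n^{-\frac{1}{k}}(\sigma_1\sigma_2\cdots\sigma_k)^{\frac{1}{k}} \le \epsilon_n(D) \le 4\cdot\sup_{1\le k<\infty} n^{-\frac{1}{k}}(\sigma_1\sigma_2\cdots\sigma_k)^{\frac{1}{k}},$$ and if $\ell_p$ is the complex $\ell_p$ space, $$\sup_{1\le k<\infty} n^{-\frac{1}{2k}}(\sigma_1\sigma_2\cdots\sigma_k)^{\frac{1}{k}} \le \epsilon_n(D) \le 4\cdot\sup_{1\le k<\infty} n^{-\frac{1}{2k}}(\sigma_1\sigma_2\cdots\sigma_k)^{\frac{1}{k}}.$$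
   Context: For normed linear spaces $X, Y$ and a bounded linear operator $S : X \to Y$, let $U_X = \{x \in X : \|x\| \le 1\}$ be the closed unit ball of $X$ and, for $y_0 \in Y$ and $r>0$, let $U(y_0,r) = \{y \in Y : \|y-y_0\| \le r\}$. For $n \in \mathbb{N} = \{1,2,\dots\}$, the $n$-th entropy number of $S$ is $$\epsilon_n(S) := \inf\Big\{\epsilon>0 : \text{there exist } k \le n \text{ and } y_1,\dots,y_k \in Y \text{ such that } S(U_X) \subseteq \bigcup_{i=1}^k U(y_i,\epsilon)\Big\}.$$ The suprema are over positive integers $k$. The space $\ell_p$ consists of the $p$-summable sequences of real (respectively complex) scalars, with its usual norm. *)

theory Defs
  imports Complex_Main
begin

text \<open>
  The exponent \<open>p\<close> of a sequence space is a term, so that space cannot be a type of class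
  \<open>real_normed_vector\<close>. Normed spaces are therefore given by a carrier set together with a
  norm function. Sequences are indexed from \<open>0\<close>: the entry \<open>x k\<close> is the mathematical
  \<open>x\<^sub>k\<^sub>+\<^sub>1\<close>.
\<close>

definition lp_space :: "real \<Rightarrow> (nat \<Rightarrow> 'a::real_normed_field) set" where
  "lp_space p = {x. summable (\<lambda>k. norm (x k) powr p)}"

definition lp_norm :: "real \<Rightarrow> (nat \<Rightarrow> 'a::real_normed_field) \<Rightarrow> real" where
  "lp_norm p x = (\<Sum>k. norm (x k) powr p) powr (1 / p)"

definition closed_ball_in :: "'a::minus set \<Rightarrow> ('a \<Rightarrow> real) \<Rightarrow> 'a \<Rightarrow> real \<Rightarrow> 'a set" where
  "closed_ball_in Y N y0 r = {y \<in> Y. N (y - y0) \<le> r}"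

definition unit_ball_in :: "'a set \<Rightarrow> ('a \<Rightarrow> real) \<Rightarrow> 'a set" where
  "unit_ball_in X N = {x \<in> X. N x \<le> 1}"

text \<open>
  The \<open>n\<close>-th entropy number of a bounded linear \<open>S\<close> from the normed space \<open>(X, NX)\<close> to the
  normed space \<open>(Y, NY)\<close>. The infimum is over a nonempty set when \<open>S\<close> is bounded and
  \<open>n \<ge> 1\<close>; outside these conditions the value carries no meaning.
\<close>

definition entropy_number ::
  "'a set \<Rightarrow> ('a \<Rightarrow> real) \<Rightarrow> 'b::minus set \<Rightarrow> ('b \<Rightarrow> real) \<Rightarrow> ('a \<Rightarrow> 'b) \<Rightarrow> nat \<Rightarrow> real" where
  "entropy_number X NX Y NY S n =
    Inf {\<epsilon>. \<epsilon> > 0 \<and> (\<exists>k\<in>{1..n}. \<exists>y. (\<forall>i\<in>{1..k}. y i \<in> Y) \<and>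
      S ` unit_ball_in X NX \<subseteq> (\<Union>i\<in>{1..k}. closed_ball_in Y NY (y i) \<epsilon>))}"

definition diag_op :: "(nat \<Rightarrow> real) \<Rightarrow> (nat \<Rightarrow> 'a::real_normed_field) \<Rightarrow> nat \<Rightarrow> 'a" where
  "diag_op \<sigma> \<zeta> = (\<lambda>k. of_real (\<sigma> k) * \<zeta> k)"

text \<open>
  The remaining facts show that the real-valued suprema and infima in use are over bounded,
  nonempty sets, so that the default values of \<open>Sup\<close> and \<open>Inf\<close> play no role.
\<close>

lemma bdd_above_geometric_means:
  fixes \<sigma> :: "nat \<Rightarrow> real" and c :: real
  assumes "decseq \<sigma>" "\<And>k. 0 \<le> \<sigma> k" "1 \<le> n" "0 < c"
  shows "bdd_above ((\<lambda>k. real n powr (- 1 / (c * real k)) * (\<Prod>i<k. \<sigma> i) powr (1 / real k)) ` {1..})"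
proof (rule bdd_aboveI2)
  fix k :: nat assume k: "k \<in> {1..}"
  have "(\<Prod>i<k. \<sigma> i) \<le> (\<Prod>i<k. \<sigma> 0)"
    using assms by (intro prod_mono) (auto simp: decseq_def)
  then have "(\<Prod>i<k. \<sigma> i) powr (1 / real k) \<le> (\<sigma> 0 ^ k) powr (1 / real k)"
    using assms by (intro powr_mono2) (auto intro: prod_nonneg)
  also have "\<dots> = \<sigma> 0"
    using k assms(2)[of 0] by (cases "\<sigma> 0 = 0") (auto simp: powr_powr simp flip: powr_realpow)
  finally have "(\<Prod>i<k. \<sigma> i) powr (1 / real k) \<le> \<sigma> 0" .
  moreover have "real n powr (- 1 / (c * real k)) \<le> real n powr 0"
    using assms by (intro powr_mono) auto
  then have "real n powr (- 1 / (c * real k)) \<le> 1"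
    using assms by auto
  ultimately show "real n powr (- 1 / (c * real k)) * (\<Prod>i<k. \<sigma> i) powr (1 / real k) \<le> 1 * \<sigma> 0"
    by (intro mult_mono) auto
qed

lemma diag_op_bounded:
  fixes x :: "nat \<Rightarrow> 'a::real_normed_field"
  assumes "1 < p" "decseq \<sigma>" "\<And>k. 0 \<le> \<sigma> k" "x \<in> lp_space p"
  shows "diag_op \<sigma> x \<in> lp_space p" "lp_norm p (diag_op \<sigma> x) \<le> \<sigma> 0 * lp_norm p x"
proof -
  have le: "norm (diag_op \<sigma> x k) powr p \<le> \<sigma> 0 powr p * norm (x k) powr p" for k
  proof -
    have "norm (diag_op \<sigma> x k) \<le> \<sigma> 0 * norm (x k)"
      using assms by (auto simp: diag_op_def norm_mult decseq_def intro!: mult_right_mono)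
    then have "norm (diag_op \<sigma> x k) powr p \<le> (\<sigma> 0 * norm (x k)) powr p"
      using assms(1) by (intro powr_mono2) auto
    then show ?thesis
      using assms(3) by (simp add: powr_mult)
  qed
  have s: "summable (\<lambda>k. norm (x k) powr p)"
    using assms(4) by (simp add: lp_space_def)
  have s': "summable (\<lambda>k. norm (diag_op \<sigma> x k) powr p)"
    using le by (intro summable_comparison_test'[OF summable_mult[OF s], of 0]) auto
  then show "diag_op \<sigma> x \<in> lp_space p"
    by (simp add: lp_space_def)
  have "(\<Sum>k. norm (diag_op \<sigma> x k) powr p) \<le> \<sigma> 0 powr p * (\<Sum>k. norm (x k) powr p)"
    using suminf_le[OF le s' summable_mult[OF s]] suminf_mult[OF s] by simp
  then have "lp_norm p (diag_op \<sigma> x)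
      \<le> (\<sigma> 0 powr p * (\<Sum>k. norm (x k) powr p)) powr (1 / p)"
    unfolding lp_norm_def using assms(1) s' by (intro powr_mono2) (auto intro: suminf_nonneg)
  also have "\<dots> = \<sigma> 0 * lp_norm p x"
    using assms(1,3) s by (simp add: powr_mult powr_powr lp_norm_def suminf_nonneg)
  finally show "lp_norm p (diag_op \<sigma> x) \<le> \<sigma> 0 * lp_norm p x" .
qed

lemma diag_op_entropy_set_nonempty:
  fixes \<sigma> :: "nat \<Rightarrow> real" and n :: nat
  assumes "1 < p" "decseq \<sigma>" "\<And>k. 0 \<le> \<sigma> k" "1 \<le> n"
  shows "\<exists>\<epsilon>>0. \<exists>k\<in>{1..n}. \<exists>y. (\<forall>i\<in>{1..k}. y i \<in> lp_space p) \<and>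
      diag_op \<sigma> ` unit_ball_in (lp_space p :: (nat \<Rightarrow> 'a::real_normed_field) set) (lp_norm p)
        \<subseteq> (\<Union>i\<in>{1..k}. closed_ball_in (lp_space p) (lp_norm p) (y i) \<epsilon>)"
proof -
  have "diag_op \<sigma> ` unit_ball_in (lp_space p :: (nat \<Rightarrow> 'a) set) (lp_norm p)
        \<subseteq> closed_ball_in (lp_space p) (lp_norm p) (\<lambda>_. 0) (\<sigma> 0 + 1)"
  proof (rule image_subsetI)
    fix x :: "nat \<Rightarrow> 'a" assume "x \<in> unit_ball_in (lp_space p) (lp_norm p)"
    then have x: "x \<in> lp_space p" "lp_norm p x \<le> 1"
      by (auto simp: unit_ball_in_def)
    have "\<sigma> 0 * lp_norm p x \<le> \<sigma> 0 * 1"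
      using x assms(3) by (intro mult_left_mono) auto
    then have "lp_norm p (diag_op \<sigma> x) \<le> \<sigma> 0 + 1"
      using diag_op_bounded(2)[OF assms(1-3) x(1)] by linarith
    then show "diag_op \<sigma> x \<in> closed_ball_in (lp_space p) (lp_norm p) (\<lambda>_. 0) (\<sigma> 0 + 1)"
      using diag_op_bounded(1)[OF assms(1-3) x(1)]
      by (simp add: closed_ball_in_def fun_diff_def)
  qed
  moreover have "(\<lambda>_. 0 :: 'a) \<in> lp_space p"
    by (simp add: lp_space_def)
  moreover have "\<sigma> 0 + 1 > 0" "(1::nat) \<in> {1..n}"
    using assms(3)[of 0] assms(4) by auto
  ultimately show ?thesis
    by (intro exI[of _ "\<sigma> 0 + 1"] conjI bexI[of _ 1] exI[of _ "\<lambda>_ _. 0"]) auto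
qed

end

theory Submission
  imports Defs "HOL-Analysis.Analysis"
begin

text \<open>
  The lower bound compares, in the first \<open>k\<close> coordinates, the volume of the image of the unit ball with
  that of the covering balls.

  For the upper bound let \<open>\<delta>\<close> be the supremum and let \<open>r\<close> count the \<open>\<sigma> k > 3 \<delta>\<close>. The centres are
  supported on the first \<open>r\<close> coordinates. With \<open>c = \<sigma> r / \<delta> \<le> 3\<close>, a point \<open>x\<close> of the unit ball whose
  head has norm \<open>a\<close> has a tail of norm at most \<open>(1 - a\<^sup>p)\<^bsup>1/p\<^esup>\<close>; since
  \<open>(4 - c + c a)\<^sup>p + c\<^sup>p (1 - a\<^sup>p) \<le> 4\<^sup>p\<close>, it suffices to approximate the head of its image up to
  \<open>(4 - c + c a) \<delta>\<close>. So heads are grouped into at most three shells, each covered by a maximal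
  separated set with its own radius. The volume bound gives on the shell \<open>\<alpha> \<le> a \<le> \<alpha>'\<close> at most
  \<open>(2 \<alpha>' / (4 - c + c \<alpha>) + 1 / 3)\<^sup>d P\<close> centres, where \<open>d\<close> is the real dimension of the head and
  \<open>P = \<Prod>k<r. \<sigma> k / \<delta>\<close> (squared in the complex case). The definition of \<open>\<delta>\<close> at \<open>k = r\<close> and \<open>k = r + 1\<close>
  leaves room for \<open>max 1 c \<cdot> P\<close> centres, which pays for the extra shells.
\<close>

section \<open>Convexity of powers\<close>

text \<open>Away from 0 this is \<open>powr_convex\<close>. If one of the two points is 0, it
  reduces to \<open>a powr p \<le> a\<close> for weights \<open>a\<close> between 0 and 1.\<close>

lemma convex_on_powr_atLeast_0:
  assumes "(1::real) \<le> p"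
  shows "convex_on {0..} (\<lambda>x. x powr p)"
proof (rule convex_onI)
  fix t x y :: real
  assume t: "0 < t" "t < 1" and xy: "x \<in> {0..}" "y \<in> {0..}"
  have shrink: "(a * z) powr p \<le> a * z powr p" if "0 < a" "a < 1" "0 \<le> z" for a z :: real
  proof -
    have "a powr p \<le> a powr 1"
      using that assms by (intro powr_mono') auto
    then show ?thesis
      using that by (auto simp: powr_mult intro: mult_right_mono)
  qed
  consider "x = 0" | "y = 0" | "x > 0" "y > 0" using xy by fastforce
  then show "((1 - t) *\<^sub>R x + t *\<^sub>R y) powr p \<le> (1 - t) * x powr p + t * y powr p"
  proof cases
    case 3
    then show ?thesis
      using convex_onD[OF powr_convex[OF assms], of t x y] t by simp
  qed (use shrink[of t y] shrink[of "1 - t" x] t xy assms in auto)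
qed simp

text \<open>For positive \<open>a\<close>, \<open>b\<close>, the quotient
  \<open>(u k + v k) / (a + b)\<close> is the convex combination of \<open>u k / a\<close> and
  \<open>v k / b\<close> with weights \<open>a / (a + b)\<close> and \<open>b / (a + b)\<close>. If
  a bound is 0, its family vanishes.\<close>

lemma Minkowski_sum_powr:
  fixes u v :: "'b \<Rightarrow> real"
  assumes p: "1 \<le> p" and ab: "0 \<le> a" "0 \<le> b"
    and u: "\<And>k. k \<in> I \<Longrightarrow> 0 \<le> u k" and v: "\<And>k. k \<in> I \<Longrightarrow> 0 \<le> v k" and I: "finite I"
    and ua: "(\<Sum>k\<in>I. u k powr p) \<le> a powr p" and vb: "(\<Sum>k\<in>I. v k powr p) \<le> b powr p"
  shows "(\<Sum>k\<in>I. (u k + v k) powr p) \<le> (a + b) powr p"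
proof -
  have zero: "w k = 0" if "(\<Sum>k\<in>I. w k powr p) \<le> 0 powr p" "k \<in> I" "\<And>k. k \<in> I \<Longrightarrow> 0 \<le> w k"
    for w :: "'b \<Rightarrow> real" and k
  proof -
    have "(\<Sum>k\<in>I. w k powr p) = 0"
      using that by (intro antisym sum_nonneg) auto
    then have "w k powr p = 0"
      using that I by (subst (asm) sum_nonneg_eq_0_iff) auto
    then show ?thesis by simp
  qed
  consider "a = 0" | "b = 0" | "a > 0" "b > 0" using ab by linarith
  then show ?thesis
  proof cases
    case 1
    then show ?thesis using zero[of u] ua u vb by (simp cong: sum.cong)
  next
    case 2
    then show ?thesis using zero[of v] vb v ua by (simp cong: sum.cong)
  next
    case 3
    define t where "t = b / (a + b)"
    have t: "0 \<le> t" "t \<le> 1" "1 - t = a / (a + b)"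
      using 3 by (auto simp: t_def field_simps)
    have "((u k + v k) / (a + b)) powr p
        \<le> (1 - t) * (u k / a) powr p + t * (v k / b) powr p" if "k \<in> I" for k
    proof -
      have "(1 - t) * (u k / a) + t * (v k / b) = (u k + v k) / (a + b)"
        using 3 by (simp add: t(3)) (simp add: t_def add_divide_distrib)
      then show ?thesis
        using convex_onD[OF convex_on_powr_atLeast_0[OF p] t(1,2), of "u k / a" "v k / b"] u v that 3
        by auto
    qed
    then have "(\<Sum>k\<in>I. ((u k + v k) / (a + b)) powr p)
        \<le> (\<Sum>k\<in>I. (1 - t) * (u k / a) powr p + t * (v k / b) powr p)"
      by (rule sum_mono)
    also have "\<dots> = (1 - t) * ((\<Sum>k\<in>I. u k powr p) / a powr p) + t * ((\<Sum>k\<in>I. v k powr p) / b powr p)"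
      using u v 3 by (simp add: sum.distrib powr_divide sum_divide_distrib sum_distrib_left cong: sum.cong)
    also have "\<dots> \<le> (1 - t) * 1 + t * 1"
      using 3 ua vb t by (intro add_mono mult_left_mono) auto
    finally have "(\<Sum>k\<in>I. (u k + v k) powr p) / (a + b) powr p \<le> 1"
      using u v 3 by (simp add: powr_divide sum_divide_distrib cong: sum.cong)
    then show ?thesis using 3 by (simp add: field_simps)
  qed
qed

text \<open>Increments of a convex function grow. The points \<open>u + v\<close> and
  \<open>w\<close> divide the interval from \<open>u\<close> to \<open>w + v\<close> with
  complementary weights, so the two convexity inequalities add up to the claim.\<close>

lemma powr_add_diff_mono:
  fixes u v w p :: real
  assumes p: "1 \<le> p" and uw: "0 \<le> u" "u \<le> w" "0 \<le> v"
  shows "(u + v) powr p - u powr p \<le> (w + v) powr p - w powr p"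
proof (cases "u = w + v")
  case True
  then show ?thesis using uw by auto
next
  case False
  define t where "t = v / (w + v - u)"
  have D: "w + v - u > 0" using False uw by auto
  then have t: "0 \<le> t" "t \<le> 1" "t * (w + v - u) = v"
    using uw by (auto simp: t_def field_simps)
  have c: "convex_on {0..} (\<lambda>x::real. x powr p)" by (rule convex_on_powr_atLeast_0[OF p])
  have e1: "(1 - t) * u + t * (w + v) = u + v" and e2: "(1 - (1 - t)) * u + (1 - t) * (w + v) = w"
    using t(3) by (auto simp: algebra_simps)
  have "(u + v) powr p \<le> (1 - t) * u powr p + t * (w + v) powr p"
    using convex_onD[OF c t(1,2), of u "w + v"] uw by (simp add: e1)
  moreover have "w powr p \<le> t * u powr p + (1 - t) * (w + v) powr p"
    using convex_onD[OF c, of "1 - t" u "w + v"] e2 t uw by simp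
  ultimately show ?thesis by (simp add: algebra_simps)
qed

section \<open>Volumes of ellipsoids\<close>

text \<open>The measure space \<open>PiM {..<r}\<close> lives on functions that are \<open>undefined\<close> from \<open>r\<close> on.\<close>

abbreviation coord_lborel :: "nat \<Rightarrow> (nat \<Rightarrow> 'a::euclidean_space) measure" where
  "coord_lborel r \<equiv> PiM {..<r} (\<lambda>_. lborel)"

text \<open>Semi-axes \<open>\<sigma>\<close> and centre 0 give the image of the unit ball in the
  first \<open>r\<close> coordinates, constant semi-axes give a ball of that radius. Both sides of
  each volume comparison are thus of one kind.\<close>

definition lp_ellipsoid ::
  "real \<Rightarrow> nat \<Rightarrow> (nat \<Rightarrow> 'a::euclidean_space) \<Rightarrow> (nat \<Rightarrow> real) \<Rightarrow> (nat \<Rightarrow> 'a) set" where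
  "lp_ellipsoid p r y s =
    {x \<in> extensional {..<r}. (\<Sum>k<r. (norm (x k - y k) / s k) powr p) \<le> 1}"

lemma lp_ellipsoid_measurable [measurable]:
  "lp_ellipsoid p r y s \<in> sets (coord_lborel r)"
proof -
  have "{x \<in> space (coord_lborel r). (\<Sum>k<r. (norm (x k - y k) / s k) powr p) \<le> 1}
      \<in> sets (coord_lborel r)"
    by measurable
  then show ?thesis
    by (simp add: lp_ellipsoid_def space_PiM PiE_def)
qed

interpretation coord_lborel: product_sigma_finite "\<lambda>_. lborel"
  by standard

text \<open>A measure on the product is determined by boxes, and on a box each factor scales by
  \<open>s k ^ DIM('a)\<close>.\<close>

lemma coord_lborel_affine:
  fixes y :: "nat \<Rightarrow> 'a::euclidean_space"
  assumes s: "\<And>k. k < r \<Longrightarrow> 0 < s k"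
  shows "coord_lborel r = density (distr (coord_lborel r) (coord_lborel r)
      (\<lambda>x. \<lambda>k\<in>{..<r}. y k + s k *\<^sub>R x k)) (\<lambda>_. ennreal (\<Prod>k<r. s k ^ DIM('a)))"
    (is "?M = ?D")
proof (rule sym, rule coord_lborel.PiM_eqI)
  let ?T = "\<lambda>x. \<lambda>k\<in>{..<r}. y k + s k *\<^sub>R x k"
  fix A :: "nat \<Rightarrow> 'a set" assume A: "\<And>i. i \<in> {..<r} \<Longrightarrow> A i \<in> sets lborel"
  have T: "?T \<in> measurable ?M ?M"
    by measurable
  define A' where "A' = (\<lambda>k. (\<lambda>z. y k + s k *\<^sub>R z) -` A k)"
  have A': "A' i \<in> sets lborel" if "i \<in> {..<r}" for i
    using measurable_sets[of "\<lambda>z. y i + s i *\<^sub>R z" lborel lborel "A i"] A[OF that] by (simp add: A'_def)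
  have PA: "Pi\<^sub>E {..<r} A \<in> sets ?M"
    using A by (intro sets_PiM_I_finite) auto
  have "?T -` Pi\<^sub>E {..<r} A \<inter> space ?M = Pi\<^sub>E {..<r} A'"
    by (auto simp: space_PiM A'_def PiE_def Pi_def)
  then have "emeasure ?D (Pi\<^sub>E {..<r} A) = ennreal (\<Prod>k<r. s k ^ DIM('a)) * emeasure ?M (Pi\<^sub>E {..<r} A')"
    using PA T by (simp add: emeasure_density_const emeasure_distr)
  also have "\<dots> = (\<Prod>k<r. ennreal (s k ^ DIM('a))) * (\<Prod>k<r. emeasure lborel (A' k))"
    using A' s by (subst coord_lborel.emeasure_PiM, simp, simp, subst prod_ennreal)
      (simp_all add: less_imp_le)
  also have "\<dots> = (\<Prod>k<r. ennreal (s k ^ DIM('a)) * emeasure lborel (A' k))"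
    by (simp add: prod.distrib)
  also have "\<dots> = (\<Prod>k<r. emeasure lborel (A k))"
  proof (rule prod.cong)
    fix k assume "k \<in> {..<r}"
    then have "s k \<noteq> 0" "A k \<in> sets borel" using s[of k] A[of k] by auto
    then show "ennreal (s k ^ DIM('a)) * emeasure lborel (A' k) = emeasure lborel (A k)"
      using s[of k] \<open>k \<in> {..<r}\<close>
      by (subst (2) lborel_affine[of "s k" "y k"])
         (simp_all add: emeasure_density_const emeasure_distr A'_def)
  qed simp
  finally show "emeasure ?D (Pi\<^sub>E {..<r} A) = (\<Prod>k<r. emeasure lborel (A k))" .
qed auto

lemma emeasure_lp_ellipsoid:
  fixes y :: "nat \<Rightarrow> 'a::euclidean_space"
  assumes s: "\<And>k. k < r \<Longrightarrow> 0 < s k"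
  shows "emeasure (coord_lborel r) (lp_ellipsoid p r y s) =
    ennreal (\<Prod>k<r. s k ^ DIM('a)) * emeasure (coord_lborel r) (lp_ellipsoid p r (\<lambda>_. 0 :: 'a) (\<lambda>_. 1))"
proof -
  let ?T = "\<lambda>x::nat \<Rightarrow> 'a. \<lambda>k\<in>{..<r}. y k + s k *\<^sub>R x k"
  have T: "?T \<in> measurable (coord_lborel r) (coord_lborel r)"
    by measurable
  have sm: "(\<Sum>k<r. (norm (s k *\<^sub>R x k) / s k) powr p) = (\<Sum>k<r. norm (x k) powr p)" for x :: "nat \<Rightarrow> 'a"
    using s by (intro sum.cong) (auto simp: less_imp_neq[symmetric] abs_of_pos)
  have "?T -` lp_ellipsoid p r y s \<inter> space (coord_lborel r) = lp_ellipsoid p r (\<lambda>_. 0) (\<lambda>_. 1)"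
    using sm by (auto simp: lp_ellipsoid_def space_PiM PiE_def)
  then show ?thesis
    using T by (subst coord_lborel_affine[of r s y, OF s])
      (simp_all add: emeasure_density_const emeasure_distr)
qed

lemma emeasure_lp_unit_ball:
  assumes p: "1 \<le> p"
  shows "0 < emeasure (coord_lborel r) (lp_ellipsoid p r (\<lambda>_. 0 :: 'a::euclidean_space) (\<lambda>_. 1))"
    and "emeasure (coord_lborel r) (lp_ellipsoid p r (\<lambda>_. 0 :: 'a::euclidean_space) (\<lambda>_. 1)) < \<infinity>"
proof -
  let ?M = "coord_lborel r :: (nat \<Rightarrow> 'a) measure"
  let ?B = "lp_ellipsoid p r (\<lambda>_. 0 :: 'a) (\<lambda>_. 1)"
  \<comment> \<open>As \<open>\<eta> \<le> 1 \<le> p\<close>, each coordinate below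
    \<open>\<eta>\<close> contributes at most \<open>\<eta>\<close> to the sum, in total at most 1.
    The added 1 in the denominator covers \<open>r = 0\<close>.\<close>
  define \<eta> where "\<eta> = 1 / (real r + 1)"
  have \<eta>: "0 < \<eta>" "\<eta> \<le> 1" "real r * \<eta> \<le> 1" by (auto simp: \<eta>_def field_simps)
  have "Pi\<^sub>E {..<r} (\<lambda>_. ball 0 \<eta>) \<subseteq> ?B"
  proof
    fix x :: "nat \<Rightarrow> 'a" assume x: "x \<in> Pi\<^sub>E {..<r} (\<lambda>_. ball 0 \<eta>)"
    have "(\<Sum>k<r. norm (x k) powr p) \<le> (\<Sum>k<r. \<eta>)"
    proof (rule sum_mono)
      fix k assume "k \<in> {..<r}"
      then have "norm (x k) < \<eta>" using x by (auto simp: PiE_iff)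
      then have "norm (x k) powr p \<le> \<eta> powr p" using p by (intro powr_mono2) auto
      also have "\<dots> \<le> \<eta> powr 1" using p \<eta> by (intro powr_mono') auto
      finally show "norm (x k) powr p \<le> \<eta>" using \<eta> by simp
    qed
    then show "x \<in> ?B" using x \<eta> by (auto simp: lp_ellipsoid_def PiE_iff)
  qed
  then have "emeasure ?M (Pi\<^sub>E {..<r} (\<lambda>_. ball 0 \<eta>)) \<le> emeasure ?M ?B"
    by (intro emeasure_mono) auto
  moreover have "0 < emeasure ?M (Pi\<^sub>E {..<r} (\<lambda>_. ball 0 \<eta>))"
  proof -
    have "emeasure lborel (ball (0::'a) \<eta>) \<noteq> 0"
      using content_ball_pos[of \<eta> "0::'a"] \<eta> by (metis enn2real_0 measure_def less_irrefl)
    then have "emeasure ?M (Pi\<^sub>E {..<r} (\<lambda>_. ball 0 \<eta>)) \<noteq> 0"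
      by (subst coord_lborel.emeasure_PiM) auto
    then show ?thesis by (simp only: zero_less_iff_neq_zero not_False_eq_True)
  qed
  ultimately show "0 < emeasure ?M ?B" by order
  have "?B \<subseteq> Pi\<^sub>E {..<r} (\<lambda>_. cball 0 1)"
  proof
    fix x :: "nat \<Rightarrow> 'a" assume x: "x \<in> ?B"
    have "norm (x k) \<le> 1" if "k < r" for k
    proof (rule ccontr)
      assume "\<not> norm (x k) \<le> 1"
      then have "1 powr p < norm (x k) powr p" using p by (intro powr_less_mono2) auto
      also have "\<dots> \<le> (\<Sum>k<r. norm (x k) powr p)" using that by (intro member_le_sum) auto
      finally show False using x by (auto simp: lp_ellipsoid_def)
    qed
    then show "x \<in> Pi\<^sub>E {..<r} (\<lambda>_. cball 0 1)" using x by (auto simp: lp_ellipsoid_def PiE_iff)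
  qed
  then have "emeasure ?M ?B \<le> emeasure ?M (Pi\<^sub>E {..<r} (\<lambda>_. cball 0 1))"
    by (intro emeasure_mono sets_PiM_I_finite) auto
  also have "\<dots> < \<infinity>"
    using emeasure_lborel_cball_finite[of "0::'a" 1]
    by (subst coord_lborel.emeasure_PiM) (auto simp: power_less_top_ennreal)
  finally show "emeasure ?M ?B < \<infinity>" .
qed

section \<open>Covering ellipsoids\<close>

text \<open>The volume \<open>v\<close> of the unit ball is never computed: it is positive and
  finite, and cancels in both counting lemmas below.\<close>

lemma emeasure_lp_ellipsoid_real:
  assumes "1 \<le> p"
  obtains v where "0 < v"
    and "\<And>(y :: nat \<Rightarrow> 'a::euclidean_space) s. (\<And>k. k < r \<Longrightarrow> 0 < s k) \<Longrightarrow>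
      emeasure (coord_lborel r) (lp_ellipsoid p r y s) = ennreal ((\<Prod>k<r. s k) ^ DIM('a) * v)"
proof -
  define v where "v = enn2real (emeasure (coord_lborel r) (lp_ellipsoid p r (\<lambda>_. 0 :: 'a) (\<lambda>_. 1)))"
  have v: "emeasure (coord_lborel r) (lp_ellipsoid p r (\<lambda>_. 0 :: 'a) (\<lambda>_. 1)) = ennreal v"
    using emeasure_lp_unit_ball(2)[OF assms, of r, where 'a='a] by (simp add: v_def)
  then have "0 < v"
    using emeasure_lp_unit_ball(1)[OF assms, of r, where 'a='a] by simp
  moreover have "emeasure (coord_lborel r) (lp_ellipsoid p r y s) = ennreal ((\<Prod>k<r. s k) ^ DIM('a) * v)"
    if "\<And>k. k < r \<Longrightarrow> 0 < s k" for y :: "nat \<Rightarrow> 'a" and s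
    using that \<open>0 < v\<close>
    by (subst emeasure_lp_ellipsoid) (simp_all add: v ennreal_mult'' prod_power_distrib)
  ultimately show thesis by (rule that)
qed

lemma lp_ellipsoid_const:
  assumes "0 < \<rho>" "0 < p"
  shows "x \<in> lp_ellipsoid p r y (\<lambda>_. \<rho>) \<longleftrightarrow>
    x \<in> extensional {..<r} \<and> (\<Sum>k<r. norm (x k - y k) powr p) \<le> \<rho> powr p"
  using assms by (simp add: lp_ellipsoid_def powr_divide flip: sum_divide_distrib)

text \<open>The ellipsoid with semi-axes \<open>\<sigma>\<close> is covered by the balls of radius
  \<open>\<epsilon>\<close>, so its volume is at most the sum of theirs.\<close>

lemma lp_volume_le_card:
  fixes y :: "'i \<Rightarrow> nat \<Rightarrow> 'a::euclidean_space"
  assumes p: "1 \<le> p" and \<sigma>: "\<And>k. k < r \<Longrightarrow> 0 < \<sigma> k" and \<epsilon>: "0 < \<epsilon>" and I: "finite I"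
    and cov: "\<And>h :: nat \<Rightarrow> 'a. (\<Sum>k<r. norm (h k) powr p) \<le> 1 \<Longrightarrow>
      \<exists>i\<in>I. (\<Sum>k<r. norm (\<sigma> k *\<^sub>R h k - y i k) powr p) \<le> \<epsilon> powr p"
  shows "(\<Prod>k<r. \<sigma> k) ^ DIM('a) \<le> real (card I) * \<epsilon> ^ (DIM('a) * r)"
proof -
  let ?M = "coord_lborel r :: (nat \<Rightarrow> 'a) measure"
  let ?E = "\<lambda>i. lp_ellipsoid p r (y i) (\<lambda>_. \<epsilon>)"
  obtain v where v: "0 < v" "\<And>(y :: nat \<Rightarrow> 'a) s. (\<And>k. k < r \<Longrightarrow> 0 < s k) \<Longrightarrow>
      emeasure ?M (lp_ellipsoid p r y s) = ennreal ((\<Prod>k<r. s k) ^ DIM('a) * v)"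
    using emeasure_lp_ellipsoid_real[OF p, of r, where 'a='a] by metis
  have sub: "lp_ellipsoid p r (\<lambda>_. 0 :: 'a) \<sigma> \<subseteq> (\<Union>i\<in>I. ?E i)"
  proof
    fix x assume x: "x \<in> lp_ellipsoid p r (\<lambda>_. 0 :: 'a) \<sigma>"
    define h where "h = (\<lambda>k. inverse (\<sigma> k) *\<^sub>R x k)"
    have "norm (h k) = norm (x k) / \<sigma> k" if "k < r" for k
      using \<sigma>[OF that] by (simp add: h_def divide_inverse_commute)
    then have "(\<Sum>k<r. norm (h k) powr p) \<le> 1"
      using x by (simp add: lp_ellipsoid_def)
    then obtain i where "i \<in> I" "(\<Sum>k<r. norm (\<sigma> k *\<^sub>R h k - y i k) powr p) \<le> \<epsilon> powr p"
      using cov by blast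
    moreover have "\<sigma> k *\<^sub>R h k = x k" if "k < r" for k
      using \<sigma>[OF that] by (simp add: h_def)
    ultimately show "x \<in> (\<Union>i\<in>I. ?E i)"
      using x \<epsilon> p by (auto simp: lp_ellipsoid_const) (auto simp: lp_ellipsoid_def)
  qed
  have "ennreal ((\<Prod>k<r. \<sigma> k) ^ DIM('a) * v) = emeasure ?M (lp_ellipsoid p r (\<lambda>_. 0 :: 'a) \<sigma>)"
    using v \<sigma> by simp
  also have "\<dots> \<le> emeasure ?M (\<Union>i\<in>I. ?E i)"
    using sub I by (intro emeasure_mono sets.finite_UN) auto
  also have "\<dots> \<le> (\<Sum>i\<in>I. emeasure ?M (?E i))"
    using I by (intro emeasure_subadditive_finite) auto
  also have "\<dots> = ennreal (\<Sum>i\<in>I. (\<Prod>k<r. \<epsilon>) ^ DIM('a) * v)"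
    using v \<epsilon> by (subst sum_ennreal[symmetric]) auto
  finally have "(\<Prod>k<r. \<sigma> k) ^ DIM('a) * v \<le> real (card I) * ((\<Prod>k<r. \<epsilon>) ^ DIM('a)) * v"
    using v \<epsilon> by (subst (asm) ennreal_le_iff) (auto intro!: mult_nonneg_nonneg)
  then show ?thesis
    using v(1) by (simp add: power_mult mult.commute[of "DIM('a)"])
qed

text \<open>Packing: by the triangle inequality the balls of radius \<open>\<rho>\<close> about the
  points of \<open>F\<close> are disjoint. The condition on \<open>\<beta>\<close> puts a ball of
  radius \<open>\<rho>\<close> about 0 inside \<open>\<beta>\<close> times the ellipsoid, so all of
  them lie in the ellipsoid scaled by \<open>\<alpha> + \<beta>\<close>.\<close>

lemma lp_card_separated_le:
  fixes F :: "(nat \<Rightarrow> 'a::euclidean_space) set"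
  assumes p: "1 \<le> p" and \<sigma>: "\<And>k. k < r \<Longrightarrow> 0 < \<sigma> k" and \<rho>: "0 < \<rho>" and \<alpha>: "0 \<le> \<alpha>"
    and \<beta>: "0 < \<beta>" "\<And>k. k < r \<Longrightarrow> \<rho> \<le> \<beta> * \<sigma> k" and F: "finite F"
    and FD: "\<And>y. y \<in> F \<Longrightarrow> (\<Sum>k<r. (norm (y k) / \<sigma> k) powr p) \<le> \<alpha> powr p"
    and sep: "\<And>y z. y \<in> F \<Longrightarrow> z \<in> F \<Longrightarrow> y \<noteq> z \<Longrightarrow> (2 * \<rho>) powr p < (\<Sum>k<r. norm (y k - z k) powr p)"
  shows "real (card F) * \<rho> ^ (DIM('a) * r) \<le> (\<alpha> + \<beta>) ^ (DIM('a) * r) * (\<Prod>k<r. \<sigma> k) ^ DIM('a)"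
proof -
  let ?M = "coord_lborel r :: (nat \<Rightarrow> 'a) measure"
  let ?E = "\<lambda>y. lp_ellipsoid p r y (\<lambda>_. \<rho>)"
  let ?B = "lp_ellipsoid p r (\<lambda>_. 0 :: 'a) (\<lambda>k. (\<alpha> + \<beta>) * \<sigma> k)"
  have p0: "0 < p" using p by simp
  obtain v where v: "0 < v" "\<And>(y :: nat \<Rightarrow> 'a) s. (\<And>k. k < r \<Longrightarrow> 0 < s k) \<Longrightarrow>
      emeasure ?M (lp_ellipsoid p r y s) = ennreal ((\<Prod>k<r. s k) ^ DIM('a) * v)"
    using emeasure_lp_ellipsoid_real[OF p, of r, where 'a='a] by metis
  have disj: "disjoint_family_on ?E F"
    unfolding disjoint_family_on_def
  proof (intro ballI impI, rule ccontr)
    fix y z assume yz: "y \<in> F" "z \<in> F" "y \<noteq> z" and "?E y \<inter> ?E z \<noteq> {}"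
    then obtain x where x: "(\<Sum>k<r. norm (x k - y k) powr p) \<le> \<rho> powr p"
      "(\<Sum>k<r. norm (x k - z k) powr p) \<le> \<rho> powr p"
      using lp_ellipsoid_const[OF \<rho> p0] by blast
    have "norm (y k - z k) \<le> norm (x k - y k) + norm (x k - z k)" for k
      using norm_triangle_ineq4[of "x k - z k" "x k - y k"] by simp
    then have "(\<Sum>k<r. norm (y k - z k) powr p) \<le> (\<Sum>k<r. (norm (x k - y k) + norm (x k - z k)) powr p)"
      using p by (intro sum_mono powr_mono2) auto
    also have "\<dots> \<le> (\<rho> + \<rho>) powr p"
      using p \<rho> x by (intro Minkowski_sum_powr) auto
    finally show False using sep[OF yz] by simp
  qed
  have sub: "?E y \<subseteq> ?B" if y: "y \<in> F" for y
  proof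
    fix x assume x: "x \<in> ?E y"
    have "norm (x k) / \<sigma> k \<le> norm (y k) / \<sigma> k + \<beta> * (norm (x k - y k) / \<rho>)" if "k < r" for k
    proof -
      have "norm (x k - y k) * \<rho> \<le> norm (x k - y k) * (\<beta> * \<sigma> k)"
        using \<beta>(2)[OF that] by (intro mult_left_mono) auto
      then have "norm (x k - y k) / \<sigma> k \<le> \<beta> * (norm (x k - y k) / \<rho>)"
        using \<rho> \<sigma>[OF that] by (simp add: field_simps)
      moreover have "norm (x k) / \<sigma> k \<le> (norm (y k) + norm (x k - y k)) / \<sigma> k"
        using \<sigma>[OF that] norm_triangle_ineq[of "y k" "x k - y k"] by (intro divide_right_mono) auto
      ultimately show ?thesis by (simp add: add_divide_distrib)
    qed
    then have "(\<Sum>k<r. (norm (x k) / \<sigma> k) powr p)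
        \<le> (\<Sum>k<r. (norm (y k) / \<sigma> k + \<beta> * (norm (x k - y k) / \<rho>)) powr p)"
      using p \<sigma> by (intro sum_mono powr_mono2) (auto simp: less_imp_le)
    also have "\<dots> \<le> (\<alpha> + \<beta>) powr p"
    proof (rule Minkowski_sum_powr)
      have "(\<Sum>k<r. (norm (x k - y k) / \<rho>) powr p) \<le> 1"
        using x by (simp add: lp_ellipsoid_def)
      then have "\<beta> powr p * (\<Sum>k<r. (norm (x k - y k) / \<rho>) powr p) \<le> \<beta> powr p * 1"
        by (intro mult_left_mono) auto
      then show "(\<Sum>k<r. (\<beta> * (norm (x k - y k) / \<rho>)) powr p) \<le> \<beta> powr p"
        using \<beta>(1) \<rho> by (simp add: powr_mult sum_distrib_left del: times_divide_eq_right)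
    qed (use p \<alpha> \<beta> \<rho> \<sigma> FD[OF y] in \<open>auto simp: less_imp_le\<close>)
    finally have "(\<Sum>k<r. (norm (x k) / \<sigma> k) powr p) / (\<alpha> + \<beta>) powr p \<le> 1"
      using \<alpha> \<beta> by simp
    moreover have "(norm (x k) / ((\<alpha> + \<beta>) * \<sigma> k)) powr p = (norm (x k) / \<sigma> k) powr p / (\<alpha> + \<beta>) powr p"
      if "k < r" for k
      using \<alpha> \<beta>(1) \<sigma>[OF that] by (simp add: powr_divide powr_mult)
    ultimately show "x \<in> ?B"
      using x by (auto simp: lp_ellipsoid_def sum_divide_distrib)
  qed
  have "ennreal (\<Sum>y\<in>F. (\<Prod>k<r. \<rho>) ^ DIM('a) * v) = (\<Sum>y\<in>F. emeasure ?M (?E y))"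
    using v \<rho> by (subst sum_ennreal[symmetric]) auto
  also have "\<dots> = emeasure ?M (\<Union>y\<in>F. ?E y)"
    using F disj by (intro sum_emeasure) auto
  also have "\<dots> \<le> emeasure ?M ?B"
    using sub by (intro emeasure_mono) auto
  also have "\<dots> = ennreal ((\<Prod>k<r. (\<alpha> + \<beta>) * \<sigma> k) ^ DIM('a) * v)"
    using v \<sigma> \<alpha> \<beta>(1) by simp
  finally have "real (card F) * ((\<Prod>k<r. \<rho>) ^ DIM('a)) * v \<le> (\<Prod>k<r. (\<alpha> + \<beta>) * \<sigma> k) ^ DIM('a) * v"
    using v(1) \<alpha> \<beta>(1) \<sigma> by (subst (asm) ennreal_le_iff) (auto intro!: mult_nonneg_nonneg prod_nonneg zero_le_power simp: less_imp_le)
  then show ?thesis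
    using v(1) by (simp add: power_mult prod.distrib power_mult_distrib mult.commute[of "DIM('a)"])
qed

text \<open>The bound on cardinalities provides a largest separated set; a further point far from
  all its members could be added to it.\<close>

lemma maximal_separated_set:
  fixes S :: "'b set" and far :: "'b \<Rightarrow> 'b \<Rightarrow> bool" and m :: nat
  assumes sym: "\<And>x y. far x y \<Longrightarrow> far y x"
    and bound: "\<And>F. finite F \<Longrightarrow> F \<subseteq> S \<Longrightarrow> pairwise far F \<Longrightarrow> card F \<le> m"
  obtains F where "finite F" "F \<subseteq> S" "pairwise far F" "\<And>x. x \<in> S \<Longrightarrow> x \<in> F \<or> (\<exists>y\<in>F. \<not> far x y)"
proof -
  let ?P = "\<lambda>F. finite F \<and> F \<subseteq> S \<and> pairwise far F"
  obtain F where F: "?P F" "\<And>G. ?P G \<Longrightarrow> card G \<le> card F"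
    using ex_has_greatest_nat[of ?P "{}" card "Suc m"] bound by (auto simp: less_Suc_eq_le)
  have "x \<in> F \<or> (\<exists>y\<in>F. \<not> far x y)" if "x \<in> S" for x
  proof (rule ccontr)
    assume "\<not> (x \<in> F \<or> (\<exists>y\<in>F. \<not> far x y))"
    then have "?P (insert x F)" "card (insert x F) = Suc (card F)"
      using F(1) that sym by (auto simp: pairwise_insert)
    then show False using F(2)[of "insert x F"] by simp
  qed
  then show thesis using F(1) that by blast
qed

text \<open>A maximal set with mutual distances above \<open>2 * \<rho>\<close> is a net of radius
  \<open>2 * \<rho>\<close>, and the packing bound limits its size.\<close>

lemma lp_ellipsoid_cover:
  assumes p: "1 \<le> p" and \<sigma>: "\<And>k. k < r \<Longrightarrow> 0 < \<sigma> k" and \<rho>: "0 < \<rho>" and \<alpha>: "0 \<le> \<alpha>"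
    and \<beta>: "0 < \<beta>" "\<And>k. k < r \<Longrightarrow> \<rho> \<le> \<beta> * \<sigma> k"
  obtains F :: "(nat \<Rightarrow> 'a::euclidean_space) set" where "finite F"
    and "real (card F) \<le> ((\<alpha> + \<beta>) / \<rho>) ^ (DIM('a) * r) * (\<Prod>k<r. \<sigma> k) ^ DIM('a)"
    and "\<And>y k. y \<in> F \<Longrightarrow> r \<le> k \<Longrightarrow> y k = 0"
    and "\<And>h. (\<Sum>k<r. norm (h k) powr p) \<le> \<alpha> powr p \<Longrightarrow>
      \<exists>y\<in>F. (\<Sum>k<r. norm (\<sigma> k *\<^sub>R h k - y k) powr p) \<le> (2 * \<rho>) powr p"
proof -
  define emb where "emb h = (\<lambda>k. if k < r then \<sigma> k *\<^sub>R h k else 0)" for h :: "nat \<Rightarrow> 'a"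
  define S where "S = emb ` {h. (\<Sum>k<r. norm (h k) powr p) \<le> \<alpha> powr p}"
  define far where "far y z \<longleftrightarrow> (2 * \<rho>) powr p < (\<Sum>k<r. norm (y k - z k) powr p)" for y z :: "nat \<Rightarrow> 'a"
  let ?m = "((\<alpha> + \<beta>) / \<rho>) ^ (DIM('a) * r) * (\<Prod>k<r. \<sigma> k) ^ DIM('a)"
  have bound: "real (card F) \<le> ?m" if F: "finite F" "F \<subseteq> S" "pairwise far F" for F
  proof -
    have "(\<Sum>k<r. (norm (y k) / \<sigma> k) powr p) \<le> \<alpha> powr p" if y: "y \<in> F" for y
    proof -
      obtain h where h: "(\<Sum>k<r. norm (h k) powr p) \<le> \<alpha> powr p" "y = emb h"
        using y F(2) unfolding S_def by blast
      have "norm (y k) / \<sigma> k = norm (h k)" if "k < r" for k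
        using that \<sigma>[OF that] by (simp add: h(2) emb_def)
      then show ?thesis using h(1) by simp
    qed
    then have "real (card F) * \<rho> ^ (DIM('a) * r) \<le> (\<alpha> + \<beta>) ^ (DIM('a) * r) * (\<Prod>k<r. \<sigma> k) ^ DIM('a)"
      using F by (intro lp_card_separated_le[OF p \<sigma> \<rho> \<alpha> \<beta>]) (auto simp: pairwise_def far_def)
    then show ?thesis using \<rho> by (simp add: power_divide field_simps)
  qed
  obtain F where F: "finite F" "F \<subseteq> S" "pairwise far F" "\<And>x. x \<in> S \<Longrightarrow> x \<in> F \<or> (\<exists>y\<in>F. \<not> far x y)"
  \<comment> \<open>The integer bound only ensures that a largest set exists; its size is then
    estimated by the real bound again.\<close>
  proof (rule maximal_separated_set[of far S "nat \<lfloor>?m\<rfloor>"])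
    show "far z y" if "far y z" for y z
      using that by (simp add: far_def norm_minus_commute)
    show "card F \<le> nat \<lfloor>?m\<rfloor>" if "finite F" "F \<subseteq> S" "pairwise far F" for F
      using bound[OF that] by (simp add: le_nat_floor)
  qed blast
  show thesis
  proof (rule that[OF F(1) bound[OF F(1-3)]])
    show "y k = 0" if "y \<in> F" "r \<le> k" for y k
      using that F(2) by (auto simp: S_def emb_def)
    fix h :: "nat \<Rightarrow> 'a" assume "(\<Sum>k<r. norm (h k) powr p) \<le> \<alpha> powr p"
    then have "emb h \<in> S" by (auto simp: S_def)
    then obtain y where "y \<in> F" "\<not> far (emb h) y"
      using F(4)[of "emb h"] \<rho> p by (auto simp: far_def)
    then show "\<exists>y\<in>F. (\<Sum>k<r. norm (\<sigma> k *\<^sub>R h k - y k) powr p) \<le> (2 * \<rho>) powr p"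
      by (intro bexI[of _ y]) (auto simp: far_def emb_def not_less)
  qed
qed

section \<open>Choice of the shells\<close>

text \<open>
  The case distinction below is numerical: \<open>3 / 10\<close> is one admissible inner radius for \<open>c\<close> near \<open>1\<close>, while
  \<open>1 - 1 / c\<close> and \<open>(c\<^sup>2 - c - 3) / c\<^sup>2\<close> are the radii for which \<open>2 \<alpha>' / (4 - c + c \<alpha>) + 1 / 3 = 1\<close>
  on every shell but the innermost.
\<close>

lemma shell_count_single:
  fixes c :: real
  assumes "1 \<le> c" "c \<le> 3"
  shows "2 / (4 - c) + 1 / 3 \<le> c" and "c \<le> 7 / 5 \<Longrightarrow> (2 / (4 - c) + 1 / 3)\<^sup>2 \<le> c"
proof -
  have e: "2 / (4 - c) + 1 / 3 = (10 - c) / (3 * (4 - c))"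
    using assms by (simp add: field_simps)
  have "0 \<le> (c - 1) * (10 - 3 * c)" using assms by (intro mult_nonneg_nonneg) auto
  then show "2 / (4 - c) + 1 / 3 \<le> c"
    unfolding e using assms by (simp add: divide_le_eq algebra_simps)
  assume c: "c \<le> 7 / 5"
  \<comment> \<open>Adding \<open>30 - 7 / 5 * c\<close>, which is nonnegative, gives the quadratic
    cofactor of \<open>c - 1\<close>.\<close>
  have "0 \<le> (7 / 5 - c) * (50 - 9 * c)"
    using assms c by (intro mult_nonneg_nonneg) auto
  then have "0 \<le> 9 * c * c - 64 * c + 100"
    using c by (simp add: field_simps)
  then have "0 \<le> (c - 1) * (9 * c * c - 64 * c + 100)"
    using assms by (intro mult_nonneg_nonneg) auto
  also have "\<dots> = c * (3 * (4 - c))\<^sup>2 - (10 - c)\<^sup>2"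
    by (simp add: power2_eq_square algebra_simps)
  finally show "(2 / (4 - c) + 1 / 3)\<^sup>2 \<le> c"
    unfolding e power_divide using assms by (simp add: divide_le_eq)
qed

text \<open>For two shells meeting at \<open>3 / 10\<close>. Both bases are at most 1, so
  \<open>d = 3\<close> is the worst case.\<close>

lemma shell_count_3_10:
  fixes c :: real
  assumes c: "1 \<le> c" "c \<le> 7 / 5" and d: "3 \<le> d"
  shows "(2 * (3 / 10) / (4 - c) + 1 / 3) ^ d + (2 / (4 - c + c * (3 / 10)) + 1 / 3) ^ d \<le> c"
proof -
  define x where "x = c - 1"
  have x: "0 \<le> x" "x \<le> 2 / 5" and cx: "c = 1 + x" using c by (auto simp: x_def)
  have x2: "x * x \<le> 2 / 5 * x" using x by (intro mult_right_mono) auto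
  have x3: "x * (x * x) \<le> 2 / 5 * (x * x)" using x by (intro mult_right_mono) auto
  let ?u = "2 * (3 / 10) / (4 - c) + 1 / 3" and ?v = "2 / (4 - c + c * (3 / 10)) + 1 / 3"
  \<comment> \<open>Linear majorants in \<open>x\<close>, just above the values
    \<open>8 / 15\<close> and \<open>31 / 33\<close> of the two bases at
    \<open>x = 0\<close>.\<close>
  let ?U = "5334 / 10000 + 8 / 100 * x" and ?V = "9395 / 10000 + 141 / 1000 * x"
  have u: "0 \<le> ?u" "?u \<le> ?U"
    using c x x2 by (simp_all add: cx field_simps)
  have v: "0 \<le> ?v" "?v \<le> ?V"
    using c x x2 by (simp_all add: cx field_simps)
  have "?U \<le> 1" "?V \<le> 1" using x by auto
  then have u1: "?u \<le> 1" and v1: "?v \<le> 1" using u v by linarith+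
  have "?u ^ d + ?v ^ d \<le> ?u ^ 3 + ?v ^ 3"
    by (rule add_mono[OF power_decreasing[OF d u(1) u1] power_decreasing[OF d v(1) v1]])
  also have "\<dots> \<le> ?U ^ 3 + ?V ^ 3"
    by (rule add_mono[OF power_mono[OF u(2,1)] power_mono[OF v(2,1)]])
  also have "\<dots> \<le> 1 + x"
    using x x2 x3 by (simp add: power3_eq_cube field_simps)
  finally show ?thesis by (simp add: cx)
qed

text \<open>The innermost of two shells, ending at \<open>1 - 1 / c\<close>. The outer one counts 1,
  which leaves \<open>c - 1\<close> of the available \<open>c\<close>.\<close>

lemma shell_count_two:
  fixes c :: real
  assumes c: "7 / 5 \<le> c" "c * c - c - 3 \<le> 0" and d: "2 \<le> d"
  shows "(2 * (1 - 1 / c) / (4 - c) + 1 / 3) ^ d \<le> c - 1"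
proof -
  have c3: "c < 3"
  proof (rule ccontr)
    assume "\<not> c < 3"
    then have "0 \<le> (c - 3) * (c + 2)" by (intro mult_nonneg_nonneg) auto
    then show False using c by (simp add: algebra_simps)
  qed
  define u where "u = 2 * (1 - 1 / c) / (4 - c) + 1 / 3"
  have pos: "0 < c * (4 - c)" using c c3 by (intro mult_pos_pos) auto
  have e: "u = 2 * (c - 1) / (c * (4 - c)) + 1 / 3"
    using c c3 by (simp add: u_def divide_simps)
  have u0: "0 \<le> u" using c pos unfolding e by (intro add_nonneg_nonneg divide_nonneg_pos) auto
  \<comment> \<open>This is the hypothesis \<open>c * c - c - 3 \<le> 0\<close> rearranged: the
    second radius suffices exactly as long as the inner base is at most 1.\<close>
  have "2 * (c - 1) \<le> 2 / 3 * (c * (4 - c))" using c by (simp add: algebra_simps)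
  then have "2 * (c - 1) / (c * (4 - c)) \<le> 2 / 3" using pos by (simp add: divide_le_eq)
  then have u1: "u \<le> 1" unfolding e by linarith
  have "u ^ d \<le> u ^ 2" using u0 u1 d by (intro power_decreasing) auto
  also have "u ^ 2 \<le> c - 1"
  proof (cases "2 \<le> c")
    case True
    have "u ^ 2 \<le> 1" using u0 u1 by (intro power_le_one)
    then show ?thesis using True by simp
  next
    case False
    define x where "x = c - 1"
    have x: "2 / 5 \<le> x" "x \<le> 1" and cx: "c = 1 + x" using c False by (auto simp: x_def)
    \<comment> \<open>Expanded, \<open>2 * x - x * x \<ge> 16 / 25\<close>, and
      \<open>c * (4 - c) = 3 + 2 * x - x * x\<close>.\<close>
    have "0 \<le> (x - 2 / 5) * (8 / 5 - x)" using x by (intro mult_nonneg_nonneg) auto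
    then have "91 / 25 \<le> c * (4 - c)"
      using x by (simp add: cx field_simps)
    then have "2 * (c - 1) / (c * (4 - c)) \<le> 2 * (c - 1) / (91 / 25)"
      using x by (intro divide_left_mono) (auto simp: cx)
    then have "u \<le> 55 / 100 * x + 334 / 1000" unfolding e using x by (simp add: cx)
    then have "u ^ 2 \<le> (55 / 100 * x + 334 / 1000) ^ 2" using u0 by (intro power_mono) auto
    also have "\<dots> \<le> x"
    proof -
      have "0 \<le> (x - 2 / 5) * (1 - x)" using x by (intro mult_nonneg_nonneg) auto
      then show ?thesis using x by (simp add: power2_eq_square field_simps)
    qed
    finally show ?thesis by (simp add: x_def)
  qed
  finally show ?thesis by (simp add: u_def)
qed

text \<open>The innermost of three shells; the outer two count 1 each. Equality holds at
  \<open>c = 3\<close>, so the estimate is expanded in \<open>y = 3 - c\<close> with a linear bound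
  on the base.\<close>

lemma shell_count_three:
  fixes c :: real
  assumes c: "1 \<le> c" "0 < c * c - c - 3" "c \<le> 3" and d: "2 \<le> d"
  shows "(2 * ((c * c - c - 3) / (c * c)) / (4 - c) + 1 / 3) ^ d \<le> c - 2"
proof -
  define u where "u = 2 * ((c * c - c - 3) / (c * c)) / (4 - c) + 1 / 3"
  define y where "y = 3 - c"
  have cy: "c = 3 - y" and y0: "0 \<le> y" using c by (auto simp: y_def)
  have y1: "y \<le> 7 / 10"
  proof (rule ccontr)
    assume "\<not> y \<le> 7 / 10"
    then have "0 \<le> (23 / 10 - c) * (c + 13 / 10)" using c by (intro mult_nonneg_nonneg) (auto simp: y_def)
    then show False using c by (simp add: algebra_simps)
  qed
  have u0: "0 \<le> u" using c unfolding u_def by (intro add_nonneg_nonneg divide_nonneg_pos mult_nonneg_nonneg divide_nonneg_nonneg) auto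
  have "u \<le> 1 - 9 / 10 * y"
  proof -
    have pos: "0 < c * c * (4 - c)" using c by (intro mult_pos_pos) auto
    \<comment> \<open>Replacing \<open>y^3\<close> by \<open>7 / 10 * y^2\<close> in the cubic below
      leaves a quadratic; subtracting the square of \<open>23 / 2 * y - 21 / 2\<close> from it
      leaves nonnegative coefficients.\<close>
    have "0 \<le> (7 / 10 - y) * (y * y)" using y1 by (intro mult_nonneg_nonneg[OF _ zero_le_square]) auto
    moreover have "0 \<le> (23 / 2 * y - 21 / 2)\<^sup>2" "0 \<le> y * y" by auto
    ultimately have "0 \<le> 117 - 241 * y + 155 * (y * y) - 27 * (y * (y * y))"
      using y0 by (simp add: power2_eq_square field_simps)
    then have "0 \<le> y * (117 - 241 * y + 155 * (y * y) - 27 * (y * (y * y)))"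
      using y0 by (intro mult_nonneg_nonneg)
    also have "\<dots> = 30 * ((2 / 3 - 9 / 10 * y) * (c * c * (4 - c)) - 2 * (c * c - c - 3))"
      by (simp add: cy field_simps)
    finally have "2 * (c * c - c - 3) \<le> (2 / 3 - 9 / 10 * y) * (c * c * (4 - c))" by simp
    then have "2 * (c * c - c - 3) / (c * c * (4 - c)) \<le> 2 / 3 - 9 / 10 * y"
      using pos by (simp add: divide_le_eq)
    then show ?thesis unfolding u_def by simp
  qed
  moreover have "1 - 9 / 10 * y \<le> 1" using y0 by simp
  ultimately have u: "u \<le> 1 - 9 / 10 * y" "u \<le> 1" by linarith+
  have "u ^ d \<le> u ^ 2" using u0 u d by (intro power_decreasing) auto
  also have "\<dots> \<le> (1 - 9 / 10 * y) ^ 2" using u0 u by (intro power_mono) auto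
  also have "\<dots> \<le> 1 - y"
  proof -
    have "0 \<le> y * (7 / 10 - y)" using y0 y1 by (intro mult_nonneg_nonneg) auto
    then show ?thesis using y0 by (simp add: power2_eq_square algebra_simps)
  qed
  finally show ?thesis by (simp add: u_def cy)
qed

text \<open>For \<open>c > 1\<close> the base of a single shell exceeds 1, which is affordable only
  for small \<open>d\<close>. Otherwise the shells are subdivided until every base is at most
  1.\<close>

lemma shell_radii_exist:
  fixes c :: real and d :: nat
  assumes c: "0 \<le> c" "c \<le> 3"
  obtains \<alpha> :: "nat \<Rightarrow> real" and J where "\<alpha> 0 = 0" "\<alpha> J = 1" "\<And>j. 0 \<le> \<alpha> j" "\<And>j. \<alpha> j \<le> 1"
    and "(\<Sum>j<J. (2 * \<alpha> (Suc j) / (4 - c + c * \<alpha> j) + 1 / 3) ^ d) \<le> max 1 c"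
proof -
  note radii = that
  have one: thesis if "(2 / (4 - c) + 1 / 3) ^ d \<le> max 1 c"
    by (rule radii[of "\<lambda>j. if j = 0 then 0 else 1" 1]) (use that in auto)
  consider "c \<le> 1" | "1 \<le> c" "d \<le> 1" | "1 \<le> c" "c \<le> 7 / 5" "d = 2"
    | "1 \<le> c" "c \<le> 7 / 5" "3 \<le> d"
    | "7 / 5 \<le> c" "c * c - c - 3 \<le> 0" "2 \<le> d" | "7 / 5 \<le> c" "0 < c * c - c - 3" "2 \<le> d"
    by fastforce
  then show thesis
  proof cases
    case 1
    then have "2 / (4 - c) \<le> 2 / 3" using c by (intro divide_left_mono) auto
    then have "(2 / (4 - c) + 1 / 3) ^ d \<le> 1" using c by (intro power_le_one) auto
    then show thesis by (intro one) auto
  next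
    case 2
    then consider "d = 0" | "d = 1" by linarith
    then show thesis
      by cases (use shell_count_single(1)[OF 2(1) c(2)] 2 in \<open>auto intro!: one\<close>)
  next
    case 3
    then show thesis using shell_count_single(2)[OF 3(1) c(2) 3(2)] by (auto intro!: one)
  next
    case 4
    show thesis
      by (rule that[of "\<lambda>j. if j = 0 then 0 else if j = 1 then 3 / 10 else 1" 2])
        (use shell_count_3_10[OF 4] 4 in \<open>auto simp: numeral_2_eq_2\<close>)
  next
    case 5
    have "2 / (4 - c + c * (1 - 1 / c)) + 1 / 3 = 1" using 5 by (simp add: algebra_simps)
    then show thesis
      by (intro that[of "\<lambda>j. if j = 0 then 0 else if j = 1 then 1 - 1 / c else 1" 2])
        (use shell_count_two[OF 5] 5 in \<open>auto simp: numeral_2_eq_2\<close>)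
  next
    case 6
    let ?a = "(c * c - c - 3) / (c * c)"
    have "2 / (4 - c + c * (1 - 1 / c)) + 1 / 3 = 1" using 6 by (simp add: algebra_simps)
    \<comment> \<open>\<open>?a\<close> is chosen for this identity: it makes the base of the middle
      shell \<open>2 / 3 + 1 / 3\<close>.\<close>
    moreover have e: "4 - c + c * ?a = 3 * (1 - 1 / c)" using 6 by (simp add: field_simps)
    have "1 - 1 / c \<noteq> 0" using 6 by simp
    then have "2 * (1 - 1 / c) / (4 - c + c * ?a) + 1 / 3 = 1"
      unfolding e by (subst nonzero_mult_divide_mult_cancel_right) simp_all
    moreover have "0 \<le> ?a" "?a \<le> 1" using 6 by (auto simp: divide_le_eq)
    ultimately show thesis
      by (intro that[of "\<lambda>j. if j = 0 then 0 else if j = 1 then ?a else if j = 2 then 1 - 1 / c else 1" 3])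
        (use shell_count_three[OF _ 6(2) c(2) 6(3)] 6 in \<open>auto simp: numeral_3_eq_3\<close>)
  qed
qed

section \<open>Entropy numbers of diagonal operators\<close>

lemma lp_norm_le_iff:
  assumes "0 < p" "x \<in> lp_space p" "0 \<le> R"
  shows "lp_norm p x \<le> R \<longleftrightarrow> (\<Sum>k. norm (x k) powr p) \<le> R powr p"
proof -
  have nn: "0 \<le> (\<Sum>k. norm (x k) powr p)"
    using assms(2) by (auto simp: lp_space_def intro: suminf_nonneg)
  have "0 \<le> lp_norm p x" by (simp add: lp_norm_def)
  then have "lp_norm p x \<le> R \<longleftrightarrow> lp_norm p x powr p \<le> R powr p"
    using assms(1,3) powr_mono2[of p "lp_norm p x" R] powr_less_mono2[of p R "lp_norm p x"] by linarith
  also have "lp_norm p x powr p = (\<Sum>k. norm (x k) powr p)"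
    using assms(1) nn by (simp add: lp_norm_def powr_powr)
  finally show ?thesis .
qed

lemma lp_space_diff:
  fixes x y :: "nat \<Rightarrow> 'a::real_normed_field"
  assumes p: "1 \<le> p" and xy: "x \<in> lp_space p" "y \<in> lp_space p"
  shows "x - y \<in> lp_space p"
proof -
  have le: "norm ((x - y) k) powr p \<le> 2 powr p * (norm (x k) powr p + norm (y k) powr p)" for k
  proof -
    have "norm ((x - y) k) \<le> 2 * max (norm (x k)) (norm (y k))"
      using norm_triangle_ineq4[of "x k" "y k"] by simp
    then have "norm ((x - y) k) powr p \<le> (2 * max (norm (x k)) (norm (y k))) powr p"
      using p by (intro powr_mono2) auto
    also have "\<dots> = 2 powr p * max (norm (x k)) (norm (y k)) powr p"
      by (simp add: powr_mult)
    also have "max (norm (x k)) (norm (y k)) powr p \<le> norm (x k) powr p + norm (y k) powr p"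
      by (auto simp: max_def)
    finally show ?thesis by simp
  qed
  have "summable (\<lambda>k. 2 powr p * (norm (x k) powr p + norm (y k) powr p))"
    using xy by (intro summable_mult summable_add) (simp_all add: lp_space_def)
  then have "summable (\<lambda>k. norm ((x - y) k) powr p)"
    by (rule summable_comparison_test'[where N = 0]) (use le in simp)
  then show ?thesis by (simp add: lp_space_def)
qed

lemma finite_support_lp_space:
  assumes "\<And>k. r \<le> k \<Longrightarrow> x k = 0"
  shows "x \<in> lp_space p"
  unfolding lp_space_def
  by (rule CollectI, rule summable_finite[of "{..<r}"]) (simp_all add: assms not_less)

text \<open>Raising to the power \<open>D * k\<close> removes the roots and leaves the form in which
  volumes are compared; \<open>D\<close> stands for the real dimension of the scalars.\<close>

lemma geometric_mean_le_iff:
  fixes \<delta> P :: real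
  assumes "1 \<le> n" "1 \<le> D" "1 \<le> k" "0 \<le> P" "0 < \<delta>"
  shows "real n powr (- 1 / (real D * real k)) * P powr (1 / real k) \<le> \<delta>
    \<longleftrightarrow> P ^ D \<le> real n * \<delta> ^ (D * k)"
proof -
  let ?e = "1 / (real D * real k)"
  have e: "0 < ?e" using assms by simp
  have "P powr (1 / real k) = (P ^ D) powr ?e"
    using assms by (cases "P = 0") (auto simp: powr_powr simp flip: powr_realpow)
  moreover have "\<delta> = (\<delta> ^ (D * k)) powr ?e"
    using assms by (simp add: powr_powr flip: powr_realpow)
  then have "(real n * \<delta> ^ (D * k)) powr ?e = real n powr ?e * \<delta>"
    using assms by (simp add: powr_mult)
  moreover have "real n powr (- 1 / (real D * real k)) = 1 / real n powr ?e"
    using powr_minus_divide[of "real n" ?e] by simp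
  moreover have "(P ^ D) powr ?e \<le> (real n * \<delta> ^ (D * k)) powr ?e \<longleftrightarrow> P ^ D \<le> real n * \<delta> ^ (D * k)"
    using assms e powr_less_mono2[OF e, of "real n * \<delta> ^ (D * k)" "P ^ D"]
    by (auto intro: powr_mono2 simp: not_le[symmetric])
  ultimately show ?thesis
    using assms by (simp add: divide_le_eq mult.commute)
qed

section \<open>Lower bound for the entropy numbers\<close>

lemma geometric_mean_le_entropy_number:
  fixes \<sigma> :: "nat \<Rightarrow> real"
  assumes p: "1 < p" and \<sigma>: "decseq \<sigma>" "\<And>k. 0 \<le> \<sigma> k" and n: "1 \<le> n" and k: "1 \<le> k"
  shows "real n powr (- 1 / (real DIM('a) * real k)) * (\<Prod>i<k. \<sigma> i) powr (1 / real k)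
    \<le> entropy_number (lp_space p :: (nat \<Rightarrow> 'a::{real_normed_field,euclidean_space}) set) (lp_norm p)
        (lp_space p :: (nat \<Rightarrow> 'a) set) (lp_norm p) (diag_op \<sigma>) n"
    (is "?g \<le> _")
  unfolding entropy_number_def
proof (rule cInf_greatest)
  fix \<epsilon>
  assume "\<epsilon> \<in> {\<epsilon>. \<epsilon> > 0 \<and> (\<exists>k\<in>{1..n}. \<exists>y. (\<forall>i\<in>{1..k}. y i \<in> lp_space p) \<and>
      diag_op \<sigma> ` unit_ball_in (lp_space p) (lp_norm p)
        \<subseteq> (\<Union>i\<in>{1..k}. closed_ball_in (lp_space p :: (nat \<Rightarrow> 'a) set) (lp_norm p) (y i) \<epsilon>))}"
  then obtain m and y :: "nat \<Rightarrow> nat \<Rightarrow> 'a" where \<epsilon>: "0 < \<epsilon>" and m: "m \<in> {1..n}"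
    and y: "\<And>i. i \<in> {1..m} \<Longrightarrow> y i \<in> lp_space p"
    and cov: "diag_op \<sigma> ` unit_ball_in (lp_space p) (lp_norm p)
        \<subseteq> (\<Union>i\<in>{1..m}. closed_ball_in (lp_space p) (lp_norm p) (y i) \<epsilon>)"
    by blast
  show "?g \<le> \<epsilon>"
  \<comment> \<open>Volumes need positive semi-axes. If one vanishes, the product is 0 and so is the
    mean, because \<open>0 powr e = 0\<close>.\<close>
  proof (cases "\<forall>i<k. 0 < \<sigma> i")
    case False
    then obtain i where "i < k" "\<sigma> i = 0" using \<sigma>(2) by (metis order_less_le)
    then have "(\<Prod>i<k. \<sigma> i) = 0" by (intro prod_zero) auto
    then show ?thesis using \<epsilon> by (simp only: powr_0 mult_zero_right)
  next
    case True
    have "(\<Prod>i<k. \<sigma> i) ^ DIM('a) \<le> real (card {1..m}) * \<epsilon> ^ (DIM('a) * k)"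
    proof (rule lp_volume_le_card[where y = y and p = p])
      fix h :: "nat \<Rightarrow> 'a" assume h: "(\<Sum>i<k. norm (h i) powr p) \<le> 1"
      \<comment> \<open>Extension by zero maps the unit ball of the first \<open>k\<close>
        coordinates into that of the sequence space. Conversely, dropping the later coordinates does
        not increase distances to the centres.\<close>
      define x where "x = (\<lambda>i. if i < k then h i else 0)"
      have x: "x \<in> lp_space p" by (rule finite_support_lp_space[of k]) (simp add: x_def)
      have "(\<Sum>i. norm (x i) powr p) = (\<Sum>i<k. norm (x i) powr p)"
        by (rule suminf_finite) (auto simp: x_def)
      also have "\<dots> \<le> 1 powr p" using h by (simp add: x_def)
      finally have "x \<in> unit_ball_in (lp_space p) (lp_norm p)"
        using lp_norm_le_iff[of p x 1] x p by (simp add: unit_ball_in_def)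
      then obtain i where i: "i \<in> {1..m}" "diag_op \<sigma> x \<in> closed_ball_in (lp_space p) (lp_norm p) (y i) \<epsilon>"
        using cov by blast
      then have d: "diag_op \<sigma> x - y i \<in> lp_space p"
        using p y by (intro lp_space_diff) (auto simp: closed_ball_in_def)
      have "(\<Sum>l<k. norm (\<sigma> l *\<^sub>R h l - y i l) powr p) = (\<Sum>l<k. norm ((diag_op \<sigma> x - y i) l) powr p)"
        by (simp add: diag_op_def x_def scaleR_conv_of_real)
      also have "\<dots> \<le> (\<Sum>l. norm ((diag_op \<sigma> x - y i) l) powr p)"
        using d by (intro sum_le_suminf) (auto simp: lp_space_def)
      also have "\<dots> \<le> \<epsilon> powr p"
        using i(2) lp_norm_le_iff[OF _ d, of \<epsilon>] p \<epsilon> by (auto simp: closed_ball_in_def)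
      finally show "\<exists>i\<in>{1..m}. (\<Sum>l<k. norm (\<sigma> l *\<^sub>R h l - y i l) powr p) \<le> \<epsilon> powr p"
        using i(1) by blast
    qed (use True \<epsilon> p in auto)
    also have "\<dots> \<le> real n * \<epsilon> ^ (DIM('a) * k)"
      using m \<epsilon> by (intro mult_right_mono) auto
    finally show ?thesis
      using n k \<epsilon> \<sigma>(2) by (subst geometric_mean_le_iff) (auto intro: prod_nonneg)
  qed
next
  show "{\<epsilon>. \<epsilon> > 0 \<and> (\<exists>k\<in>{1..n}. \<exists>y. (\<forall>i\<in>{1..k}. y i \<in> lp_space p) \<and>
      diag_op \<sigma> ` unit_ball_in (lp_space p) (lp_norm p)
        \<subseteq> (\<Union>i\<in>{1..k}. closed_ball_in (lp_space p :: (nat \<Rightarrow> 'a) set) (lp_norm p) (y i) \<epsilon>))} \<noteq> {}"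
    using diag_op_entropy_set_nonempty[OF p \<sigma> n, where 'a='a] by blast
qed

section \<open>Upper bound for the entropy numbers\<close>

lemma entropy_number_leI:
  fixes F :: "'b::minus set"
  assumes "0 < \<epsilon>" "finite F" "F \<noteq> {}" "card F \<le> n" "F \<subseteq> Y"
    and cov: "\<And>x. x \<in> unit_ball_in X NX \<Longrightarrow> \<exists>y\<in>F. S x \<in> closed_ball_in Y NY y \<epsilon>"
  shows "entropy_number X NX Y NY S n \<le> \<epsilon>"
proof -
  obtain y where y: "bij_betw y {1..card F} F"
    using ex_bij_betw_nat_finite_1[OF assms(2)] by blast
  have "\<exists>i\<in>{1..card F}. S x \<in> closed_ball_in Y NY (y i) \<epsilon>" if x: "x \<in> unit_ball_in X NX" for x
  proof -
    obtain z where "z \<in> y ` {1..card F}" "S x \<in> closed_ball_in Y NY z \<epsilon>"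
      using cov[OF x] unfolding bij_betw_imp_surj_on[OF y] by blast
    then show ?thesis by blast
  qed
  then have "S ` unit_ball_in X NX \<subseteq> (\<Union>i\<in>{1..card F}. closed_ball_in Y NY (y i) \<epsilon>)" by blast
  moreover have "\<forall>i\<in>{1..card F}. y i \<in> Y" using bij_betwE[OF y] assms(5) by blast
  moreover have "card F \<in> {1..n}" using assms(2-4) by (simp add: Suc_le_eq card_gt_0_iff)
  ultimately show ?thesis
    unfolding entropy_number_def using assms(1)
    by (intro cInf_lower bdd_belowI[of _ 0] CollectI conjI bexI[of _ "card F"] exI[of _ y]) auto
qed

text \<open>A discrete intermediate value argument, used to find the shell that contains a given
  head.\<close>

lemma ex_consecutive_between:
  fixes f :: "nat \<Rightarrow> 'b::linorder"
  assumes "f 0 \<le> a" "a \<le> f J" "0 < J"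
  obtains j where "j < J" "f j \<le> a" "a \<le> f (Suc j)"
proof -
  have "\<exists>j<J. f j \<le> a \<and> a \<le> f (Suc j)" using assms
  proof (induction J)
    case (Suc J)
    show ?case
    proof (cases "0 < J \<and> a \<le> f J")
      case True
      then show ?thesis using Suc less_SucI by blast
    next
      case False
      then show ?thesis using Suc.prems by (intro exI[of _ J]) (auto simp: not_le)
    qed
  qed simp
  then show thesis using that by blast
qed

text \<open>From \<open>r\<close> on the error is the image of \<open>x\<close> itself, where the
  factors are at most \<open>\<sigma> r\<close>. The tail is measured by the mass that the head
  leaves over, so a large head permits a larger error there.\<close>

lemma diag_op_head_tail:
  fixes x y :: "nat \<Rightarrow> 'a::real_normed_field"
  assumes p: "1 < p" and \<sigma>: "decseq \<sigma>" "\<And>k. 0 \<le> \<sigma> k" and x: "x \<in> lp_space p"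
    and y: "\<And>k. r \<le> k \<Longrightarrow> y k = 0"
  shows "(\<Sum>k. norm ((diag_op \<sigma> x - y) k) powr p)
    \<le> (\<Sum>k<r. norm (\<sigma> k *\<^sub>R x k - y k) powr p)
      + \<sigma> r powr p * ((\<Sum>k. norm (x k) powr p) - (\<Sum>k<r. norm (x k) powr p))"
proof -
  have d: "diag_op \<sigma> x - y \<in> lp_space p"
    using p diag_op_bounded(1)[OF p \<sigma> x] finite_support_lp_space[OF y, where p = p]
    by (intro lp_space_diff) auto
  have sx: "summable (\<lambda>k. norm (x k) powr p)" and sd: "summable (\<lambda>k. norm ((diag_op \<sigma> x - y) k) powr p)"
    using x d by (simp_all add: lp_space_def)
  note sx' = summable_ignore_initial_segment[OF sx, of r]
  have le: "norm ((diag_op \<sigma> x - y) (k + r)) powr p \<le> \<sigma> r powr p * norm (x (k + r)) powr p" for k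
  proof -
    have "norm ((diag_op \<sigma> x - y) (k + r)) = \<sigma> (k + r) * norm (x (k + r))"
      using \<sigma>(2) y by (simp add: diag_op_def norm_mult)
    also have "\<dots> \<le> \<sigma> r * norm (x (k + r))"
      using \<sigma>(1) by (intro mult_right_mono) (auto simp: decseq_def)
    finally have "norm ((diag_op \<sigma> x - y) (k + r)) powr p \<le> (\<sigma> r * norm (x (k + r))) powr p"
      using p by (intro powr_mono2) auto
    then show ?thesis using \<sigma>(2) by (simp add: powr_mult)
  qed
  have "(\<Sum>k. norm ((diag_op \<sigma> x - y) (k + r)) powr p) \<le> (\<Sum>k. \<sigma> r powr p * norm (x (k + r)) powr p)"
    using le summable_ignore_initial_segment[OF sd, of r] summable_mult[OF sx'] by (rule suminf_le)
  also have "\<dots> = \<sigma> r powr p * ((\<Sum>k. norm (x k) powr p) - (\<Sum>k<r. norm (x k) powr p))"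
    using suminf_mult[OF sx'] suminf_minus_initial_segment[OF sx, of r] by simp
  finally show ?thesis
    using suminf_split_initial_segment[OF sd, of r]
    by (simp add: diag_op_def scaleR_conv_of_real)
qed

lemma entropy_number_diag_op_le:
  fixes \<sigma> :: "nat \<Rightarrow> real"
  assumes p: "1 < p" and \<sigma>: "decseq \<sigma>" "\<And>k. 0 \<le> \<sigma> k" and n: "1 \<le> n" and \<delta>: "0 < \<delta>"
    and vol: "\<And>k. 1 \<le> k \<Longrightarrow> (\<Prod>i<k. \<sigma> i) ^ DIM('a) \<le> real n * \<delta> ^ (DIM('a) * k)"
  shows "entropy_number (lp_space p :: (nat \<Rightarrow> 'a::{real_normed_field,euclidean_space}) set) (lp_norm p)
        (lp_space p :: (nat \<Rightarrow> 'a) set) (lp_norm p) (diag_op \<sigma>) n \<le> 4 * \<delta>"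
proof -
  let ?D = "DIM('a)"
  \<comment> \<open>Otherwise \<open>vol\<close> at \<open>k = n\<close> would give
    \<open>3 ^ n \<le> n\<close>.\<close>
  have "\<exists>k. \<sigma> k \<le> 3 * \<delta>"
  proof (rule ccontr)
    assume "\<not> ?thesis"
    then have "(3 * \<delta>) ^ n \<le> (\<Prod>i<n. \<sigma> i)"
      using \<delta> prod_mono[of "{..<n}" "\<lambda>_. 3 * \<delta>" \<sigma>] by (auto simp: not_le less_imp_le)
    then have "((3 * \<delta>) ^ n) ^ ?D \<le> real n * \<delta> ^ (?D * n)"
      using \<delta> vol[OF n] by (meson order_trans power_mono zero_le_power less_imp_le mult_pos_pos zero_less_numeral)
    then have "3 ^ (?D * n) \<le> real n"
      using \<delta> by (simp add: power_mult_distrib mult.commute[of n] flip: power_mult)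
    moreover have "(3::real) ^ n \<le> 3 ^ (?D * n)" by (intro power_increasing) auto
    moreover have "real n < 3 ^ n"
      using of_nat_less_two_power[of n, where 'a=real] power_mono[of "2::real" 3 n] by linarith
    ultimately show False by linarith
  qed
  define r where "r = (LEAST k. \<sigma> k \<le> 3 * \<delta>)"
  have \<sigma>r: "\<sigma> r \<le> 3 * \<delta>"
    unfolding r_def using \<open>\<exists>k. \<sigma> k \<le> 3 * \<delta>\<close> by (rule LeastI_ex)
  have head: "3 * \<delta> < \<sigma> k" if "k < r" for k
    using not_less_Least[of k "\<lambda>k. \<sigma> k \<le> 3 * \<delta>"] that by (simp add: r_def)
  then have pos: "0 < \<sigma> k" if "k < r" for k
    using that \<delta> by (smt (verit))
  define c where "c = \<sigma> r / \<delta>"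
  have c: "0 \<le> c" "c \<le> 3" "\<sigma> r = c * \<delta>"
    using \<sigma>(2)[of r] \<sigma>r \<delta> by (auto simp: c_def divide_le_eq)
  obtain \<alpha> :: "nat \<Rightarrow> real" and J where \<alpha>: "\<alpha> 0 = 0" "\<alpha> J = 1" "\<And>j. 0 \<le> \<alpha> j" "\<And>j. \<alpha> j \<le> 1"
    and count: "(\<Sum>j<J. (2 * \<alpha> (Suc j) / (4 - c + c * \<alpha> j) + 1 / 3) ^ (?D * r)) \<le> max 1 c"
    by (rule shell_radii_exist[OF c(1,2), of "?D * r"]) (rule that)
  have J: "0 < J" using \<alpha>(1,2) by (cases J) auto
  \<comment> \<open>\<open>2 * \<rho> j * \<delta>\<close> is the tolerance at the inner radius, the
    smallest on the shell; the half matches the covering radius \<open>2 * \<rho>\<close> of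
    \<open>lp_ellipsoid_cover\<close>.\<close>
  define \<rho> where "\<rho> j = (4 - c + c * \<alpha> j) / 2" for j
  have \<rho>: "0 < \<rho> j" for j
    using c(2) mult_nonneg_nonneg[OF c(1) \<alpha>(3)[of j]] by (simp add: \<rho>_def)
  define P where "P = (\<Prod>k<r. \<sigma> k) ^ ?D / \<delta> ^ (?D * r)"
  \<comment> \<open>The net for shell \<open>j\<close> serves the whole ball up to its outer radius;
    only the tolerance depends on the inner radius.\<close>
  define net where "net j F \<longleftrightarrow> finite F
      \<and> real (card F) \<le> (2 * \<alpha> (Suc j) / (4 - c + c * \<alpha> j) + 1 / 3) ^ (?D * r) * P
      \<and> (\<forall>y\<in>F. \<forall>k\<ge>r. y k = 0)
      \<and> (\<forall>h. (\<Sum>k<r. norm (h k) powr p) \<le> \<alpha> (Suc j) powr p \<longrightarrow>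
          (\<exists>y\<in>F. (\<Sum>k<r. norm (\<sigma> k *\<^sub>R h k - y k) powr p) \<le> (2 * (\<rho> j * \<delta>)) powr p))"
    for j and F :: "(nat \<Rightarrow> 'a) set"
  have "\<exists>F. net j F" for j
  proof -
    \<comment> \<open>The threshold \<open>3 * \<delta>\<close> for the head enters here and
      produces the summand \<open>1 / 3\<close> of the count.\<close>
    have b: "\<rho> j * \<delta> \<le> \<rho> j / 3 * \<sigma> k" if "k < r" for k
      using head[OF that] \<rho>[of j] by simp
    have "4 - c + c * \<alpha> j = 2 * \<rho> j" by (simp add: \<rho>_def)
    then have "(\<alpha> (Suc j) + \<rho> j / 3) / (\<rho> j * \<delta>) = (2 * \<alpha> (Suc j) / (4 - c + c * \<alpha> j) + 1 / 3) / \<delta>"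
      using \<rho>[of j] \<delta> by (simp only:) (simp add: field_simps)
    then have e: "((\<alpha> (Suc j) + \<rho> j / 3) / (\<rho> j * \<delta>)) ^ (?D * r) * (\<Prod>k<r. \<sigma> k) ^ ?D
        = (2 * \<alpha> (Suc j) / (4 - c + c * \<alpha> j) + 1 / 3) ^ (?D * r) * P"
      by (simp add: P_def power_divide)
    obtain F :: "(nat \<Rightarrow> 'a) set" where "finite F"
      "real (card F) \<le> ((\<alpha> (Suc j) + \<rho> j / 3) / (\<rho> j * \<delta>)) ^ (?D * r) * (\<Prod>k<r. \<sigma> k) ^ ?D"
      "\<And>y k. y \<in> F \<Longrightarrow> r \<le> k \<Longrightarrow> y k = 0"
      "\<And>h. (\<Sum>k<r. norm (h k) powr p) \<le> \<alpha> (Suc j) powr p \<Longrightarrow>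
        \<exists>y\<in>F. (\<Sum>k<r. norm (\<sigma> k *\<^sub>R h k - y k) powr p) \<le> (2 * (\<rho> j * \<delta>)) powr p"
      using lp_ellipsoid_cover[of p r \<sigma> "\<rho> j * \<delta>" "\<alpha> (Suc j)" "\<rho> j / 3", where 'a='a]
        p pos \<rho>[of j] \<delta> \<alpha>(3) b by auto
    then show ?thesis unfolding e net_def by blast
  qed
  then obtain F where "\<And>j. net j (F j)" by metis
  then have F: "\<And>j. finite (F j)"
    "\<And>j. real (card (F j)) \<le> (2 * \<alpha> (Suc j) / (4 - c + c * \<alpha> j) + 1 / 3) ^ (?D * r) * P"
    "\<And>j y k. y \<in> F j \<Longrightarrow> r \<le> k \<Longrightarrow> y k = 0"
    "\<And>j h. (\<Sum>k<r. norm (h k) powr p) \<le> \<alpha> (Suc j) powr p \<Longrightarrow>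
      \<exists>y\<in>F j. (\<Sum>k<r. norm (\<sigma> k *\<^sub>R h k - y k) powr p) \<le> (2 * (\<rho> j * \<delta>)) powr p"
    by (simp_all add: net_def)
  have P0: "0 \<le> P" using \<delta> \<sigma>(2) by (simp add: P_def prod_nonneg)
  \<comment> \<open>For \<open>r = 0\<close>, where \<open>vol\<close> says nothing,
    \<open>P\<close> is an empty product and \<open>n \<ge> 1\<close> is used.\<close>
  have "P \<le> real n"
    using vol[of r] n \<delta> by (cases "r = 0") (auto simp: P_def divide_le_eq)
  \<comment> \<open>Index \<open>Suc r\<close> brings in one more factor
    \<open>\<sigma> r = c * \<delta>\<close>, hence \<open>c ^ ?D\<close>, which is at least
    \<open>c\<close>.\<close>
  moreover have "c * P \<le> real n" if "1 \<le> c"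
  proof -
    have "c * P \<le> c ^ ?D * P"
      using that P0 power_increasing[of 1 ?D c] by (intro mult_right_mono) (auto simp: Suc_le_eq)
    also have "\<dots> = (\<Prod>i<Suc r. \<sigma> i) ^ ?D / \<delta> ^ (?D * Suc r)"
      by (simp add: c_def P_def power_divide power_mult_distrib power_add mult.commute)
    also have "\<dots> \<le> real n"
      using vol[of "Suc r"] \<delta> by (simp add: divide_le_eq)
    finally show ?thesis .
  qed
  ultimately have maxP: "max 1 c * P \<le> real n" by (auto simp: max_def)
  let ?G = "\<Union>j<J. F j"
  have "card ?G \<le> (\<Sum>j<J. card (F j))" by (rule card_UN_le) simp
  then have "real (card ?G) \<le> (\<Sum>j<J. real (card (F j)))" by (simp flip: of_nat_sum)
  also have "\<dots> \<le> (\<Sum>j<J. (2 * \<alpha> (Suc j) / (4 - c + c * \<alpha> j) + 1 / 3) ^ (?D * r) * P)"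
    by (intro sum_mono F(2))
  also have "\<dots> \<le> max 1 c * P"
    using mult_right_mono[OF count P0] by (simp add: sum_distrib_right)
  also note maxP
  finally have cardG: "card ?G \<le> n" by simp
  have cov: "\<exists>y\<in>?G. diag_op \<sigma> x \<in> closed_ball_in (lp_space p) (lp_norm p) y (4 * \<delta>)"
    if "x \<in> unit_ball_in (lp_space p) (lp_norm p)" for x :: "nat \<Rightarrow> 'a"
  proof -
    have x: "x \<in> lp_space p" "lp_norm p x \<le> 1" using that by (auto simp: unit_ball_in_def)
    then have x1: "(\<Sum>k. norm (x k) powr p) \<le> 1" using lp_norm_le_iff[of p x 1] p by simp
    define A where "A = (\<Sum>k<r. norm (x k) powr p)"
    have "A \<le> (\<Sum>k. norm (x k) powr p)"
      unfolding A_def using x(1) by (intro sum_le_suminf) (auto simp: lp_space_def)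
    then have A: "0 \<le> A" "A \<le> 1" using x1 by (auto simp: A_def sum_nonneg)
    obtain j where j: "j < J" "\<alpha> j powr p \<le> A" "A \<le> \<alpha> (Suc j) powr p"
      using ex_consecutive_between[of "\<lambda>j. \<alpha> j powr p" A J] \<alpha>(1,2) A J by auto
    obtain y where y: "y \<in> F j" "(\<Sum>k<r. norm (\<sigma> k *\<^sub>R x k - y k) powr p) \<le> (2 * (\<rho> j * \<delta>)) powr p"
      using F(4)[of x j] j(3) by (auto simp: A_def)
    have ylp: "y \<in> lp_space p" using F(3)[OF y(1)] by (rule finite_support_lp_space)
    have "(\<Sum>k. norm ((diag_op \<sigma> x - y) k) powr p)
        \<le> (2 * (\<rho> j * \<delta>)) powr p + (c * \<delta>) powr p * ((\<Sum>k. norm (x k) powr p) - A)"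
      using diag_op_head_tail[OF p \<sigma> x(1), of r y] F(3)[OF y(1)] y(2) by (simp add: A_def c(3))
    also have "\<dots> \<le> (2 * (\<rho> j * \<delta>)) powr p + (c * \<delta>) powr p * (1 - \<alpha> j powr p)"
      using x1 j(2) by (intro add_left_mono mult_left_mono) auto
    also have "\<dots> = ((c * \<alpha> j + (4 - c)) powr p - (c * \<alpha> j) powr p + c powr p) * \<delta> powr p"
    proof -
      have "2 * (\<rho> j * \<delta>) = (c * \<alpha> j + (4 - c)) * \<delta>" by (simp add: \<rho>_def field_simps)
      then show ?thesis
        using c \<delta> \<alpha>(3)[of j] by (simp only: powr_mult) (simp add: powr_mult algebra_simps)
    qed
    \<comment> \<open>Growth of increments by \<open>4 - c\<close>: the one starting at
      \<open>c * \<alpha> j\<close> is at most the one starting at \<open>c\<close>, which is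
      \<open>4 powr p - c powr p\<close>.\<close>
    also have "\<dots> \<le> 4 powr p * \<delta> powr p"
      using powr_add_diff_mono[of p "c * \<alpha> j" c "4 - c"] p c \<alpha>(3,4)[of j]
      by (intro mult_right_mono) (auto simp: mult_left_le)
    finally have "(\<Sum>k. norm ((diag_op \<sigma> x - y) k) powr p) \<le> (4 * \<delta>) powr p"
      by (simp add: powr_mult)
    then have "lp_norm p (diag_op \<sigma> x - y) \<le> 4 * \<delta>"
      using p \<delta> x(1) ylp by (subst lp_norm_le_iff) (auto intro!: lp_space_diff diag_op_bounded[OF p \<sigma>])
    then show ?thesis
      using y(1) j(1) diag_op_bounded(1)[OF p \<sigma> x(1)] by (auto simp: closed_ball_in_def)
  qed
  show ?thesis
  proof (rule entropy_number_leI[OF _ _ _ cardG])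
    have "(\<lambda>_. 0 :: 'a) \<in> unit_ball_in (lp_space p) (lp_norm p)"
      by (simp add: unit_ball_in_def lp_space_def lp_norm_def)
    then show "?G \<noteq> {}" using cov by blast
    show "?G \<subseteq> lp_space p" using F(3) by (auto intro: finite_support_lp_space)
  qed (use \<delta> F(1) cov in auto)
qed

text \<open>Real and complex scalars are treated together, since only their real dimension
  \<open>DIM('a)\<close> enters the volumes.\<close>

lemma entropy_number_diag_op_bounds:
  fixes \<sigma> :: "nat \<Rightarrow> real"
  assumes p: "1 < p" and \<sigma>: "decseq \<sigma>" "\<And>k. 0 \<le> \<sigma> k" and n: "1 \<le> n"
  defines "G \<equiv> SUP k\<in>{1..}. real n powr (- 1 / (real DIM('a) * real k)) * (\<Prod>i<k. \<sigma> i) powr (1 / real k)"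
    and "E \<equiv> entropy_number (lp_space p :: (nat \<Rightarrow> 'a::{real_normed_field,euclidean_space}) set) (lp_norm p)
        (lp_space p :: (nat \<Rightarrow> 'a) set) (lp_norm p) (diag_op \<sigma>) n"
  shows "G \<le> E" and "E \<le> 4 * G"
proof -
  let ?g = "\<lambda>k. real n powr (- 1 / (real DIM('a) * real k)) * (\<Prod>i<k. \<sigma> i) powr (1 / real k)"
  have bdd: "bdd_above (?g ` {1..})"
    by (rule bdd_above_geometric_means[OF \<sigma> n]) simp
  show "G \<le> E"
    unfolding G_def E_def
    using geometric_mean_le_entropy_number[OF p \<sigma> n, where 'a='a] by (intro cSUP_least) auto
  have gG: "?g k \<le> G" if "1 \<le> k" for k
    unfolding G_def using bdd that by (intro cSUP_upper) auto
  have "0 \<le> ?g 1" by simp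
  then have G0: "0 \<le> G" using gG[of 1] by linarith
  \<comment> \<open>The supremum \<open>G\<close> may be 0, whereas the covering argument divides by
    \<open>\<delta>\<close>. It is therefore run for every \<open>\<delta>\<close> above
    \<open>G\<close>, and the bound follows in the limit.\<close>
  have "E / 4 \<le> \<delta>" if "G < \<delta>" for \<delta>
  proof -
    have "(\<Prod>i<k. \<sigma> i) ^ DIM('a) \<le> real n * \<delta> ^ (DIM('a) * k)" if "1 \<le> k" for k
      using gG[OF that] \<open>G < \<delta>\<close> G0 n that \<sigma>(2)
      by (subst geometric_mean_le_iff[symmetric]) (auto intro: prod_nonneg simp: Suc_le_eq)
    then have "E \<le> 4 * \<delta>"
      unfolding E_def using that G0 by (intro entropy_number_diag_op_le[OF p \<sigma> n]) auto
    then show ?thesis by simp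
  qed
  then have "E / 4 \<le> G" by (rule dense_ge)
  then show "E \<le> 4 * G" by simp
qed

theorem theorem3p1:
  fixes p :: real and \<sigma> :: "nat \<Rightarrow> real" and n :: nat
  assumes "1 < p"
    and "decseq \<sigma>"
    and "\<And>k. 0 \<le> \<sigma> k"
    and "1 \<le> n"
  shows
    "(SUP k\<in>{1..}. real n powr (- 1 / real k) * (\<Prod>i<k. \<sigma> i) powr (1 / real k))
        \<le> entropy_number (lp_space p :: (nat \<Rightarrow> real) set) (lp_norm p)
             (lp_space p :: (nat \<Rightarrow> real) set) (lp_norm p) (diag_op \<sigma>) n
     \<and> entropy_number (lp_space p :: (nat \<Rightarrow> real) set) (lp_norm p)
             (lp_space p :: (nat \<Rightarrow> real) set) (lp_norm p) (diag_op \<sigma>) n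
        \<le> 4 * (SUP k\<in>{1..}. real n powr (- 1 / real k) * (\<Prod>i<k. \<sigma> i) powr (1 / real k))
     \<and> (SUP k\<in>{1..}. real n powr (- 1 / (2 * real k)) * (\<Prod>i<k. \<sigma> i) powr (1 / real k))
        \<le> entropy_number (lp_space p :: (nat \<Rightarrow> complex) set) (lp_norm p)
             (lp_space p :: (nat \<Rightarrow> complex) set) (lp_norm p) (diag_op \<sigma>) n
     \<and> entropy_number (lp_space p :: (nat \<Rightarrow> complex) set) (lp_norm p)
             (lp_space p :: (nat \<Rightarrow> complex) set) (lp_norm p) (diag_op \<sigma>) n
        \<le> 4 * (SUP k\<in>{1..}. real n powr (- 1 / (2 * real k)) * (\<Prod>i<k. \<sigma> i) powr (1 / real k))"
  using entropy_number_diag_op_bounds[OF assms, where 'a=real]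
    entropy_number_diag_op_bounds[OF assms, where 'a=complex]
  by (simp add: DIM_complex)

end
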